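(* Let the setting be as in the context, with $0<\sigma<\infty$, $f\in L^1(\Omega)$, $g\in C^{0,1}(\partial\Omega)$ with $L\le\sigma$, and assume that there exists $\bar g\in S_g$ with $F(\bar g)<+\infty$. Let $u$ be the (unique) minimizer of $F$ on $S_g$ and set $\Sigma=\{x\in\Omega:\ |\nabla u(x)|=\sigma\}$. Let $v\in S_g$ with $F(v)<\infty$ and write $\delta_v(x)=\delta(\nabla u(x),\nabla v(x))$. Then: (i) if $\Lambda=\infty$, then $\nabla v=\nabla u$ a.e. on $\Sigma$; (ii) $\delta_v^-\in L^1(\Omega)$ and $\int_\Omega\delta_v\ \ge\ \int_\Omega f\,(v-u)$; (iii) the partial sums of the series $\sum_{p=2}^{\infty}a_p\int_\Omega|\nabla u|^{p-2}\nabla u\cdot\nabla(v-u)$ converge in $(-\infty,+\infty]$ to $\int_\Omega\delta_v$, so that $$\sum_{p=2}^{\infty}a_p\int_\Omega|\nabla u|^{p-2}\nabla u\cdot\nabla(v-u)\ \ge\ \int_\Omega f\,(v-u).$$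
   Context: $\Omega\subset\mathbb{R}^N$ ($N\ge1$) is a bounded, connected, open set with Lipschitz boundary. $\{a_p\}_{p\ge2}$ ($p$ integer) is a real sequence with $a_p\ge0$ for all $p$, $a_2>0$, and $a_p\ne0$ for infinitely many $p$; $\sigma$ is defined by $1/\sigma=\limsup_{p\to\infty}a_p^{1/p}$. Put $\Phi(t)=\sum_{p\ge2}\frac{a_p}{p}t^p\in[0,+\infty]$ for $t\in[0,\sigma]$, $\Lambda=\sum_{p\ge2}a_p\sigma^{p-1}\in(0,+\infty]$, and $\mathbf a(\xi)=\sum_{p\ge2}a_p|\xi|^{p-2}\xi$ for $|\xi|<\sigma$. Put $G(\xi)=\Phi(|\xi|)$ if $|\xi|\le\sigma$ and $G(\xi)=+\infty$ if $|\xi|>\sigma$. For $g\in C^{0,1}(\partial\Omega)$ put $L=\sup_{x\ne y\in\partial\Omega}\frac{|g(x)-g(y)|}{|x-y|}$ and $S_g=\{v\in C^{0,1}(\overline\Omega):\ \|\nabla v\|_{L^\infty(\Omega)}\le\sigma,\ v=g\text{ on }\partial\Omega\}$; for $v\in S_g$, $F(v)=\int_\Omega G(\nabla v)-\int_\Omega fv\in(-\infty,+\infty]$. Under the stated assumptions $F$ has a unique minimizer on $S_g$. For $|\xi|\le\sigma$, $|\zeta|\le\sigma$ with $G(\xi)<\infty$, and $\eta=\zeta-\xi$, the quantity $\delta(\xi,\zeta)\in[-\infty,+\infty)$ is the limit $\lim_{t\downarrow0}t^{-1}[G(\xi+t\eta)-G(\xi)]$; explicitly, $\delta(\xi,\zeta)=\mathbf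 a(\xi)\cdot\eta$ if $|\xi|<\sigma$; $\delta(\xi,\zeta)=\Lambda\sigma^{-1}\xi\cdot\eta$ if $|\xi|=\sigma$ and $\Lambda<\infty$; $\delta(\xi,\zeta)=0$ if $|\xi|=\sigma$, $\Lambda=\infty$ and $\zeta=\xi$; $\delta(\xi,\zeta)=-\infty$ if $|\xi|=\sigma$, $\Lambda=\infty$ and $\zeta\neq\xi$. $\delta_v^-$ denotes the negative part of $\delta_v$. *)

theory Defs
  imports "HOL-Analysis.Analysis"
begin

text \<open>
  Near each boundary point the set is, after choosing a direction \<open>e\<close>, the strict epigraph of a
  Lipschitz function on the hyperplane orthogonal to \<open>e\<close>. In dimension one that hyperplane
  is \<open>{0}\<close>.
\<close>

definition lipschitz_boundary :: "'a::euclidean_space set \<Rightarrow> bool" where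
  "lipschitz_boundary \<Omega> \<longleftrightarrow>
     (\<forall>z\<in>frontier \<Omega>. \<exists>r>0. \<exists>e \<gamma> C. norm e = 1 \<and>
        C-lipschitz_on {y. y \<bullet> e = 0} (\<gamma> :: 'a \<Rightarrow> real) \<and>
        \<Omega> \<inter> ball z r = {x \<in> ball z r. \<gamma> (x - (x \<bullet> e) *\<^sub>R e) < x \<bullet> e})"

definition lipschitz_fun_on :: "'a::metric_space set \<Rightarrow> ('a \<Rightarrow> real) \<Rightarrow> bool" where
  "lipschitz_fun_on X v \<longleftrightarrow> (\<exists>C. C-lipschitz_on X v)"

definition lipschitz_const :: "'a::metric_space set \<Rightarrow> ('a \<Rightarrow> real) \<Rightarrow> ereal" where
  "lipschitz_const X g =
     Sup {ereal (\<bar>g x - g y\<bar> / dist x y) | x y. x \<in> X \<and> y \<in> X \<and> x \<noteq> y}"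

text \<open>
  The classical gradient; its value is unspecified where the function is not differentiable.
\<close>

definition gradient :: "('a::real_inner \<Rightarrow> real) \<Rightarrow> 'a \<Rightarrow> 'a" where
  "gradient v x = (THE D. GDERIV v x :> D)"

text \<open>
  The coefficient sequence is used only at indices \<open>p \<ge> 2\<close>, hence the shift by two.
\<close>

definition Phi :: "(nat \<Rightarrow> real) \<Rightarrow> real \<Rightarrow> ennreal" where
  "Phi a t = (\<Sum>p. ennreal (a (p + 2) / real (p + 2) * t ^ (p + 2)))"

definition Lambda :: "(nat \<Rightarrow> real) \<Rightarrow> real \<Rightarrow> ennreal" where
  "Lambda a \<sigma> = (\<Sum>p. ennreal (a (p + 2) * \<sigma> ^ (p + 1)))"

definition G :: "(nat \<Rightarrow> real) \<Rightarrow> real \<Rightarrow> 'a::real_normed_vector \<Rightarrow> ennreal" where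
  "G a \<sigma> \<xi> = (if norm \<xi> \<le> \<sigma> then Phi a (norm \<xi>) else \<infinity>)"

text \<open>
  Functions on the closure of \<open>\<Omega>\<close> are represented by total functions whose values elsewhere are
  irrelevant. Almost everywhere differentiability is automatic for Lipschitz functions by
  Rademacher's theorem; it is spelled out because \<^const>\<open>gradient\<close> is meaningful only at points
  of differentiability.
\<close>

definition admissible ::
    "'a::euclidean_space set \<Rightarrow> real \<Rightarrow> ('a \<Rightarrow> real) \<Rightarrow> ('a \<Rightarrow> real) set" where
  "admissible \<Omega> \<sigma> g =
     {v. lipschitz_fun_on (closure \<Omega>) v \<and>
         (AE x in lebesgue_on \<Omega>. v differentiable (at x) \<and> norm (gradient v x) \<le> \<sigma>) \<and>
         (\<forall>x\<in>frontier \<Omega>. v x = g x)}"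

definition energy ::
    "'a::euclidean_space set \<Rightarrow> (nat \<Rightarrow> real) \<Rightarrow> real \<Rightarrow> ('a \<Rightarrow> real) \<Rightarrow> ('a \<Rightarrow> real) \<Rightarrow> ereal" where
  "energy \<Omega> a \<sigma> f v =
     enn2ereal (\<integral>\<^sup>+x. G a \<sigma> (gradient v x) \<partial>lebesgue_on \<Omega>)
     - ereal (\<integral>x. f x * v x \<partial>lebesgue_on \<Omega>)"

text \<open>
  The limit is taken in the extended reals. It exists whenever
  \<open>norm \<xi> \<le> \<sigma>\<close>, \<open>norm \<zeta> \<le> \<sigma>\<close> and \<open>G a \<sigma> \<xi> < \<infinity>\<close>; no other arguments are of interest.
\<close>

definition delta :: "(nat \<Rightarrow> real) \<Rightarrow> real \<Rightarrow> 'a::real_normed_vector \<Rightarrow> 'a \<Rightarrow> ereal" where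
  "delta a \<sigma> \<xi> \<zeta> =
     Lim (at_right 0) (\<lambda>t::real.
       (enn2ereal (G a \<sigma> (\<xi> + t *\<^sub>R (\<zeta> - \<xi>))) - enn2ereal (G a \<sigma> \<xi>)) / ereal t)"

text \<open>
  The function \<^const>\<open>e2ennreal\<close> sends negative numbers to \<open>0\<close>, so it yields the positive part
  of \<open>h\<close>, and of \<open>- h\<close> the negative part.
\<close>

definition neg_part_L1 :: "'a measure \<Rightarrow> ('a \<Rightarrow> ereal) \<Rightarrow> bool" where
  "neg_part_L1 M h \<longleftrightarrow>
     (\<lambda>x. e2ennreal (- h x)) \<in> borel_measurable M \<and> (\<integral>\<^sup>+x. e2ennreal (- h x) \<partial>M) < \<infinity>"

definition ereal_integral :: "'a measure \<Rightarrow> ('a \<Rightarrow> ereal) \<Rightarrow> ereal" where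
  "ereal_integral M h =
     enn2ereal (\<integral>\<^sup>+x. e2ennreal (h x) \<partial>M) - enn2ereal (\<integral>\<^sup>+x. e2ennreal (- h x) \<partial>M)"

end

theory Submission
  imports Defs
begin

text \<open>
  Expand the energy in powers of the norm. For \<open>t\<close> decreasing to \<open>0\<close>, the \<open>p\<close>-th difference
  quotient at \<open>\<nabla>u\<close> in the direction \<open>\<nabla>v - \<nabla>u\<close> lies, by convexity, between its limit and its value
  at \<open>t = 1\<close>. Hence the differences to the value at \<open>t = 1\<close> are nonnegative, and Fatou's lemma,
  for the sum over \<open>p\<close> and for the integral over \<open>\<Omega>\<close>, combined with the minimality of \<open>u\<close> bounds
  the integral of the sum of their limits. So the
  series of the limits converges almost everywhere, to \<open>\<delta>\<close> by Tannery's theorem, with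
  integrable sum and the claimed lower bound for its integral. All terms of the series carry the sign
  of \<open>\<nabla>u \<bullet> (\<nabla>v - \<nabla>u)\<close>, so that \<open>\<bar>\<delta>\<bar>\<close> dominates the partial sums and one may integrate
  termwise. Finally, where \<open>|\<nabla>u| = \<sigma>\<close> and \<open>\<Lambda> = \<infinity>\<close>, convergence forces the inner product to
  vanish, and then \<open>|\<nabla>v| \<le> \<sigma>\<close> gives \<open>\<nabla>v = \<nabla>u\<close>.
\<close>

section \<open>Powers of the norm along a segment\<close>

text \<open>The triangle inequality reduces this to convexity of the \<open>n\<close>-th power on
  the nonnegative reals, proved by induction.\<close>

lemma norm_segment_power_le:
  fixes \<xi> \<zeta> :: "'a::real_normed_vector"
  assumes "0 \<le> t" "t \<le> 1"
  shows "norm (\<xi> + t *\<^sub>R (\<zeta> - \<xi>)) ^ n \<le> (1 - t) * norm \<xi> ^ n + t * norm \<zeta> ^ n"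
proof -
  have eq: "\<xi> + t *\<^sub>R (\<zeta> - \<xi>) = (1 - t) *\<^sub>R \<xi> + t *\<^sub>R \<zeta>"
    by (simp add: algebra_simps)
  have "norm (\<xi> + t *\<^sub>R (\<zeta> - \<xi>)) \<le> (1 - t) * norm \<xi> + t * norm \<zeta>"
    unfolding eq using norm_triangle_ineq[of "(1 - t) *\<^sub>R \<xi>" "t *\<^sub>R \<zeta>"] assms by simp
  then have "norm (\<xi> + t *\<^sub>R (\<zeta> - \<xi>)) ^ n \<le> ((1 - t) * norm \<xi> + t * norm \<zeta>) ^ n"
    by (simp add: power_mono)
  also have "\<dots> \<le> (1 - t) * norm \<xi> ^ n + t * norm \<zeta> ^ n"
  proof (induction n)
    case (Suc n)
    define x y where "x = norm \<xi>" and "y = norm \<zeta>"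
    have xy: "0 \<le> x" "0 \<le> y" by (simp_all add: x_def y_def)
    \<comment> \<open>Both factors have the same sign because powers are monotone. Multiplied by
      \<open>t * (1 - t)\<close>, this product is exactly the term subtracted in the expansion
      below.\<close>
    have cheb: "0 \<le> (x - y) * (x ^ n - y ^ n)"
      using xy power_mono[of x y n] power_mono[of y x n]
      by (cases "x \<le> y") (auto intro: mult_nonneg_nonneg mult_nonpos_nonpos)
    have "((1 - t) * x + t * y) ^ Suc n \<le> ((1 - t) * x + t * y) * ((1 - t) * x ^ n + t * y ^ n)"
      using Suc xy assms by (auto simp: x_def y_def intro!: mult_left_mono)
    also have "\<dots> = (1 - t) * x ^ Suc n + t * y ^ Suc n - t * (1 - t) * ((x - y) * (x ^ n - y ^ n))"
      by (simp add: algebra_simps)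
    also have "\<dots> \<le> (1 - t) * x ^ Suc n + t * y ^ Suc n"
      using cheb assms by simp
    finally show ?case by (simp add: x_def y_def)
  qed (use assms in simp)
  finally show ?thesis .
qed

text \<open>The chain rule handles \<open>\<xi> \<noteq> 0\<close>. At the origin, where the norm
  may fail to be differentiable, the exponent is still at least two, so the quotient is
  \<open>t ^ (p + 1)\<close> times a constant and vanishes in the limit.\<close>

lemma norm_power_directional_derivative:
  fixes \<xi> \<eta> :: "'a::real_inner"
  shows "((\<lambda>t. (norm (\<xi> + t *\<^sub>R \<eta>) ^ (p + 2) - norm \<xi> ^ (p + 2)) / t)
           \<longlongrightarrow> real (p + 2) * (norm \<xi> ^ p * (\<xi> \<bullet> \<eta>))) (at_right 0)"
proof (cases "\<xi> = 0")
  case True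
  have "((\<lambda>t::real. t ^ (p + 1) * norm \<eta> ^ (p + 2)) \<longlongrightarrow> 0 ^ (p + 1) * norm \<eta> ^ (p + 2)) (at_right 0)"
    by (intro tendsto_intros)
  moreover have "\<forall>\<^sub>F t in at_right (0::real). t ^ (p + 1) * norm \<eta> ^ (p + 2)
      = (norm (\<xi> + t *\<^sub>R \<eta>) ^ (p + 2) - norm \<xi> ^ (p + 2)) / t"
    using eventually_at_right_less[of "0::real"]
    by eventually_elim (simp add: True power_mult_distrib field_simps)
  ultimately show ?thesis
    using True by (auto elim: Lim_transform_eventually)
next
  case False
  have "((\<lambda>t::real. norm (\<xi> + t *\<^sub>R \<eta>)) has_derivative (\<lambda>h. (h *\<^sub>R \<eta>) \<bullet> sgn \<xi>)) (at 0)"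
    by (rule has_derivative_compose[where g = norm and f = "\<lambda>t::real. \<xi> + t *\<^sub>R \<eta>" and g' = "\<lambda>h. h \<bullet> sgn \<xi>"])
       (auto intro!: derivative_eq_intros has_derivative_norm simp: False)
  then have "((\<lambda>t::real. norm (\<xi> + t *\<^sub>R \<eta>)) has_field_derivative (\<eta> \<bullet> sgn \<xi>)) (at 0)"
    unfolding has_field_derivative_def by (simp add: mult.commute[of _ "\<eta> \<bullet> sgn \<xi>"])
  from DERIV_power[OF this, of "p + 2"]
  have "((\<lambda>t::real. norm (\<xi> + t *\<^sub>R \<eta>) ^ (p + 2)) has_field_derivative
      real (p + 2) * (norm \<xi> ^ p * (\<xi> \<bullet> \<eta>))) (at 0)"
    by (rule DERIV_cong) (simp add: False sgn_div_norm inner_commute)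
  then show ?thesis
    unfolding DERIV_def
    by (auto intro: tendsto_within_subset)
qed

text \<open>A convex function lies above its tangent: the quotients for \<open>0 < t < 1\<close> are
  at most the one at \<open>t = 1\<close>, and this survives the limit.\<close>

lemma norm_power_tangent_le:
  fixes \<xi> \<zeta> :: "'a::real_inner"
  shows "real (p + 2) * (norm \<xi> ^ p * (\<xi> \<bullet> (\<zeta> - \<xi>))) \<le> norm \<zeta> ^ (p + 2) - norm \<xi> ^ (p + 2)"
proof (rule tendsto_upperbound[OF norm_power_directional_derivative])
  show "\<forall>\<^sub>F t in at_right 0. (norm (\<xi> + t *\<^sub>R (\<zeta> - \<xi>)) ^ (p + 2) - norm \<xi> ^ (p + 2)) / t
      \<le> norm \<zeta> ^ (p + 2) - norm \<xi> ^ (p + 2)"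
    unfolding eventually_at_right_field
  proof (intro exI[of _ 1] conjI allI impI)
    fix t :: real assume t: "0 < t" "t < 1"
    show "(norm (\<xi> + t *\<^sub>R (\<zeta> - \<xi>)) ^ (p + 2) - norm \<xi> ^ (p + 2)) / t
      \<le> norm \<zeta> ^ (p + 2) - norm \<xi> ^ (p + 2)"
      using norm_segment_power_le[of t \<xi> \<zeta> "p + 2"] t by (simp add: field_simps)
  qed simp
qed simp

section \<open>Termwise difference quotients and their limits\<close>

text \<open>
  As in \<^const>\<open>Phi\<close>, the index is shifted: \<open>p\<close> stands for the exponent \<open>p + 2\<close>.
\<close>

definition quot :: "(nat \<Rightarrow> real) \<Rightarrow> 'a::real_inner \<Rightarrow> 'a \<Rightarrow> real \<Rightarrow> nat \<Rightarrow> real" where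
  "quot a \<xi> \<zeta> t p =
     a (p + 2) / real (p + 2) * ((norm (\<xi> + t *\<^sub>R (\<zeta> - \<xi>)) ^ (p + 2) - norm \<xi> ^ (p + 2)) / t)"

text \<open>The limit of \<open>quot\<close> as \<open>t\<close> decreases to \<open>0\<close>: the
  factor \<open>real (p + 2)\<close> from differentiating the power cancels the denominator.\<close>

definition slope :: "(nat \<Rightarrow> real) \<Rightarrow> 'a::real_inner \<Rightarrow> 'a \<Rightarrow> nat \<Rightarrow> real" where
  "slope a \<xi> \<zeta> p = a (p + 2) * (norm \<xi> ^ p * (\<xi> \<bullet> (\<zeta> - \<xi>)))"

lemma quot_tendsto_slope: "((\<lambda>t. quot a \<xi> \<zeta> t p) \<longlongrightarrow> slope a \<xi> \<zeta> p) (at_right 0)"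
proof -
  have "((\<lambda>t. quot a \<xi> \<zeta> t p) \<longlongrightarrow> a (p + 2) / real (p + 2) *
      (real (p + 2) * (norm \<xi> ^ p * (\<xi> \<bullet> (\<zeta> - \<xi>))))) (at_right 0)"
    unfolding quot_def by (intro tendsto_mult tendsto_const norm_power_directional_derivative)
  then show ?thesis by (simp add: slope_def)
qed

lemma quot_le_quot_1:
  assumes "\<And>p. p \<ge> 2 \<Longrightarrow> 0 \<le> a p" "0 < t" "t \<le> 1"
  shows "quot a \<xi> \<zeta> t p \<le> quot a \<xi> \<zeta> 1 p"
  unfolding quot_def
  by (rule mult_left_mono)
     (use norm_segment_power_le[of t \<xi> \<zeta> "p + 2"] assms in \<open>auto simp: field_simps\<close>)

lemma slope_le_quot:
  assumes "\<And>p. p \<ge> 2 \<Longrightarrow> 0 \<le> a p" "0 < t"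
  shows "slope a \<xi> \<zeta> p \<le> quot a \<xi> \<zeta> t p"
proof -
  \<comment> \<open>The tangent inequality is used with the endpoint at parameter \<open>t\<close>,
    whose displacement \<open>t *\<^sub>R (\<zeta> - \<xi>)\<close> supplies the factor
    \<open>t\<close> to divide by.\<close>
  have "real (p + 2) * (norm \<xi> ^ p * (\<xi> \<bullet> (\<zeta> - \<xi>)))
      \<le> (norm (\<xi> + t *\<^sub>R (\<zeta> - \<xi>)) ^ (p + 2) - norm \<xi> ^ (p + 2)) / t"
    using norm_power_tangent_le[of p \<xi> "\<xi> + t *\<^sub>R (\<zeta> - \<xi>)"] assms(2)
    by (simp add: pos_le_divide_eq mult.assoc mult.left_commute[of t] mult.commute[of _ t])
  from mult_left_mono[OF this, of "a (p + 2) / real (p + 2)"] show ?thesis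
    using assms(1) by (simp add: quot_def slope_def)
qed

section \<open>Finiteness and summation of the energy density\<close>

text \<open>A real-valued stand-in for \<open>Phi\<close>, so that differences can be formed in the
  reals. It carries information only where the series converges.\<close>

definition phi :: "(nat \<Rightarrow> real) \<Rightarrow> real \<Rightarrow> real" where
  "phi a t = (\<Sum>p. a (p + 2) / real (p + 2) * t ^ (p + 2))"

lemma Phi_term_nonneg:
  assumes "\<And>p. p \<ge> 2 \<Longrightarrow> 0 \<le> a p" "0 \<le> t"
  shows "0 \<le> a (p + 2) / real (p + 2) * t ^ (p + 2)"
  using assms by (intro mult_nonneg_nonneg divide_nonneg_nonneg zero_le_power) auto

lemma Phi_less_top_iff:
  assumes "\<And>p. p \<ge> 2 \<Longrightarrow> 0 \<le> a p" "0 \<le> t"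
  shows "Phi a t < \<infinity> \<longleftrightarrow> summable (\<lambda>p. a (p + 2) / real (p + 2) * t ^ (p + 2))"
proof -
  have *: "0 \<le> a (p + 2) / real (p + 2) * t ^ (p + 2)" for p
    using Phi_term_nonneg[of a, OF assms] .
  show ?thesis
  proof
    assume "Phi a t < \<infinity>"
    then show "summable (\<lambda>p. a (p + 2) / real (p + 2) * t ^ (p + 2))"
      unfolding Phi_def by (intro summable_suminf_not_top[OF *]) (auto simp: less_top)
  next
    assume "summable (\<lambda>p. a (p + 2) / real (p + 2) * t ^ (p + 2))"
    then show "Phi a t < \<infinity>"
      unfolding Phi_def using suminf_ennreal2[of "\<lambda>p. a (p + 2) / real (p + 2) * t ^ (p + 2)", OF *]
      by (metis ennreal_less_top infinity_ennreal_def)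
  qed
qed

lemma Phi_summable:
  assumes "\<And>p. p \<ge> 2 \<Longrightarrow> 0 \<le> a p" "Phi a t < \<infinity>" "0 \<le> t"
  shows "summable (\<lambda>p. a (p + 2) / real (p + 2) * t ^ (p + 2))"
  using Phi_less_top_iff[OF assms(1,3)] assms(2) by simp

lemma Phi_eq_phi:
  assumes "\<And>p. p \<ge> 2 \<Longrightarrow> 0 \<le> a p" "0 \<le> t" "Phi a t < \<infinity>"
  shows "Phi a t = ennreal (phi a t)"
  unfolding Phi_def phi_def
  by (intro suminf_ennreal2 Phi_term_nonneg[OF assms(1,2)] Phi_summable[OF assms(1,3,2)])

lemma phi_nonneg:
  assumes "\<And>p. p \<ge> 2 \<Longrightarrow> 0 \<le> a p" "0 \<le> t" "Phi a t < \<infinity>"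
  shows "0 \<le> phi a t"
  unfolding phi_def
  by (intro suminf_nonneg Phi_summable[OF assms(1,3,2)] Phi_term_nonneg[OF assms(1,2)])

lemma norm_segment_le:
  fixes \<xi> \<zeta> :: "'a::real_normed_vector"
  assumes "norm \<xi> \<le> r" "norm \<zeta> \<le> r" "0 \<le> t" "t \<le> 1"
  shows "norm (\<xi> + t *\<^sub>R (\<zeta> - \<xi>)) \<le> r"
  using norm_segment_power_le[of t \<xi> \<zeta> 1] assms
    convex_bound_le[of "norm \<xi>" r "norm \<zeta>" "1 - t" t] by auto

text \<open>Convexity, applied term by term, bounds the series at the intermediate point by a
  weighted sum of the two convergent endpoint series.\<close>

lemma Phi_segment_less_top:
  fixes \<xi> \<zeta> :: "'a::real_normed_vector"
  assumes "\<And>p. p \<ge> 2 \<Longrightarrow> 0 \<le> a p" "Phi a (norm \<xi>) < \<infinity>" "Phi a (norm \<zeta>) < \<infinity>" "0 \<le> t" "t \<le> 1"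
  shows "Phi a (norm (\<xi> + t *\<^sub>R (\<zeta> - \<xi>))) < \<infinity>"
proof -
  have "summable (\<lambda>p. (1 - t) * (a (p + 2) / real (p + 2) * norm \<xi> ^ (p + 2))
      + t * (a (p + 2) / real (p + 2) * norm \<zeta> ^ (p + 2)))"
    using assms by (intro summable_add summable_mult Phi_summable) simp_all
  moreover have "norm (a (p + 2) / real (p + 2) * norm (\<xi> + t *\<^sub>R (\<zeta> - \<xi>)) ^ (p + 2))
      \<le> (1 - t) * (a (p + 2) / real (p + 2) * norm \<xi> ^ (p + 2))
      + t * (a (p + 2) / real (p + 2) * norm \<zeta> ^ (p + 2))" for p
    using mult_left_mono[OF norm_segment_power_le[of t \<xi> \<zeta> "p + 2"], of "a (p + 2) / real (p + 2)"] assms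
    by (simp add: ring_distribs mult.left_commute diff_divide_distrib del: power_add power_Suc)
  ultimately have "summable (\<lambda>p. a (p + 2) / real (p + 2) * norm (\<xi> + t *\<^sub>R (\<zeta> - \<xi>)) ^ (p + 2))"
    by (rule summable_comparison_test'[where N = 0])
  then show ?thesis
    using Phi_less_top_iff[of a, OF assms(1) norm_ge_zero] by blast
qed

lemma quot_sums:
  fixes \<xi> \<zeta> :: "'a::real_inner"
  assumes "\<And>p. p \<ge> 2 \<Longrightarrow> 0 \<le> a p" "Phi a (norm \<xi>) < \<infinity>" "Phi a (norm \<zeta>) < \<infinity>" "0 \<le> t" "t \<le> 1"
  shows "quot a \<xi> \<zeta> t sums ((phi a (norm (\<xi> + t *\<^sub>R (\<zeta> - \<xi>))) - phi a (norm \<xi>)) / t)"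
proof -
  have "(\<lambda>p. (a (p + 2) / real (p + 2) * norm (\<xi> + t *\<^sub>R (\<zeta> - \<xi>)) ^ (p + 2)
      - a (p + 2) / real (p + 2) * norm \<xi> ^ (p + 2)) / t)
      sums ((phi a (norm (\<xi> + t *\<^sub>R (\<zeta> - \<xi>))) - phi a (norm \<xi>)) / t)"
    unfolding phi_def using assms Phi_segment_less_top[OF assms]
    by (intro sums_divide sums_diff summable_sums Phi_summable) simp_all
  moreover have "quot a \<xi> \<zeta> t = (\<lambda>p. (a (p + 2) / real (p + 2) * norm (\<xi> + t *\<^sub>R (\<zeta> - \<xi>)) ^ (p + 2)
      - a (p + 2) / real (p + 2) * norm \<xi> ^ (p + 2)) / t)"
    by (auto simp: quot_def algebra_simps diff_divide_distrib)
  ultimately show ?thesis by simp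
qed

section \<open>Identification of \<open>delta\<close> with the series of slopes\<close>

text \<open>All other factors of a slope are nonnegative, so the sign does not depend on
  \<open>p\<close>. Convergence of the series is therefore absolute convergence.\<close>

lemma abs_slope:
  assumes "\<And>p. p \<ge> 2 \<Longrightarrow> 0 \<le> a p"
  shows "\<bar>slope a \<xi> \<zeta> p\<bar> = sgn (\<xi> \<bullet> (\<zeta> - \<xi>)) * slope a \<xi> \<zeta> p"
  by (cases "\<xi> \<bullet> (\<zeta> - \<xi>)" "0::real" rule: linorder_cases) (simp_all add: slope_def abs_mult assms)

text \<open>Tannery's theorem exchanges the sum over \<open>p\<close> with the limit in
  \<open>t\<close>. The argument is the same for \<open>norm \<xi> < \<sigma>\<close> and
  \<open>norm \<xi> = \<sigma>\<close>.\<close>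

lemma delta_eq_suminf_slope:
  fixes \<xi> \<zeta> :: "'a::real_inner"
  assumes a: "\<And>p. p \<ge> 2 \<Longrightarrow> 0 \<le> a p" and \<sigma>: "norm \<xi> \<le> \<sigma>" "norm \<zeta> \<le> \<sigma>"
    and fin: "Phi a (norm \<xi>) < \<infinity>" "Phi a (norm \<zeta>) < \<infinity>"
    and sum: "summable (slope a \<xi> \<zeta>)"
  shows "delta a \<sigma> \<xi> \<zeta> = ereal (\<Sum>p. slope a \<xi> \<zeta> p)"
proof -
  have abs: "summable (\<lambda>p. \<bar>slope a \<xi> \<zeta> p\<bar>)"
    using summable_mult[OF sum, of "sgn (\<xi> \<bullet> (\<zeta> - \<xi>))"] by (simp only: abs_slope[of a, OF a])
  have "summable (\<lambda>p. quot a \<xi> \<zeta> 1 p - slope a \<xi> \<zeta> p)"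
    using quot_sums[OF a fin, of 1] sum by (intro summable_diff) (auto simp: sums_iff)
  \<comment> \<open>The majorant is independent of \<open>t\<close>: since \<open>quot\<close> at
    \<open>t\<close> lies between the slope and \<open>quot\<close> at \<open>1\<close>, it exceeds
    the slope by at most their difference.\<close>
  then have bound: "summable (\<lambda>p. (quot a \<xi> \<zeta> 1 p - slope a \<xi> \<zeta> p) + \<bar>slope a \<xi> \<zeta> p\<bar>)"
    using abs by (rule summable_add)
  have "\<forall>\<^sub>F (p, t) in at_top \<times>\<^sub>F at_right 0.
      norm (quot a \<xi> \<zeta> t p) \<le> (quot a \<xi> \<zeta> 1 p - slope a \<xi> \<zeta> p) + \<bar>slope a \<xi> \<zeta> p\<bar>"
  proof -
    have "\<forall>\<^sub>F t in at_right (0::real). 0 < t \<and> t \<le> 1"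
      unfolding eventually_at_right_field by (auto intro!: exI[of _ 1])
    then have "\<forall>\<^sub>F (p::nat, t) in at_top \<times>\<^sub>F at_right (0::real). 0 < t \<and> t \<le> 1"
      using eventually_prod2[of "at_top :: nat filter" "\<lambda>t. 0 < t \<and> t \<le> 1" "at_right (0::real)"]
      by (simp add: case_prod_unfold)
    then show ?thesis
    proof (rule eventually_mono, clarify)
      fix p :: nat and t :: real assume "0 < t" "t \<le> 1"
      then show "norm (quot a \<xi> \<zeta> t p) \<le> (quot a \<xi> \<zeta> 1 p - slope a \<xi> \<zeta> p) + \<bar>slope a \<xi> \<zeta> p\<bar>"
        using quot_le_quot_1[of a t \<xi> \<zeta> p] slope_le_quot[of a t \<xi> \<zeta> p] a by simp
    qed
  qed
  from tannerys_theorem[OF quot_tendsto_slope this bound]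
  have lim: "((\<lambda>t. \<Sum>p. quot a \<xi> \<zeta> t p) \<longlongrightarrow> (\<Sum>p. slope a \<xi> \<zeta> p)) (at_right 0)"
    by simp
  \<comment> \<open>By convexity the density stays finite on the segment, so the extended-real
    quotient defining \<open>delta\<close> is an ordinary real quotient for
    \<open>0 < t < 1\<close>.\<close>
  have "\<forall>\<^sub>F t in at_right (0::real). ereal (\<Sum>p. quot a \<xi> \<zeta> t p) =
      (enn2ereal (G a \<sigma> (\<xi> + t *\<^sub>R (\<zeta> - \<xi>))) - enn2ereal (G a \<sigma> \<xi>)) / ereal t"
    unfolding eventually_at_right_field
  proof (intro exI[of _ 1] conjI allI impI)
    fix t :: real assume t: "0 < t" "t < 1"
    let ?w = "\<xi> + t *\<^sub>R (\<zeta> - \<xi>)"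
    have w: "Phi a (norm ?w) < \<infinity>" "norm ?w \<le> \<sigma>"
      using Phi_segment_less_top[OF a fin] norm_segment_le[OF \<sigma>] t by auto
    have "(\<Sum>p. quot a \<xi> \<zeta> t p) = (phi a (norm ?w) - phi a (norm \<xi>)) / t"
      using quot_sums[OF a fin, of t] t by (simp add: sums_iff)
    moreover have "enn2ereal (G a \<sigma> ?w) = ereal (phi a (norm ?w))"
      using w Phi_eq_phi[of a "norm ?w"] phi_nonneg[of a "norm ?w"] a
      by (simp add: G_def)
    moreover have "enn2ereal (G a \<sigma> \<xi>) = ereal (phi a (norm \<xi>))"
      using \<sigma> fin Phi_eq_phi[of a "norm \<xi>"] phi_nonneg[of a "norm \<xi>"] a
      by (simp add: G_def)
    ultimately show "ereal (\<Sum>p. quot a \<xi> \<zeta> t p) =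
        (enn2ereal (G a \<sigma> ?w) - enn2ereal (G a \<sigma> \<xi>)) / ereal t"
      using t by simp
  qed simp
  from Lim_transform_eventually[OF tendsto_ereal[OF lim] this] show ?thesis
    unfolding delta_def by (intro tendsto_Lim) simp_all
qed

section \<open>Fatou's lemma for the sum over exponents\<close>

text \<open>Fatou's lemma for the counting measure.\<close>

lemma suminf_liminf_le:
  fixes f :: "nat \<Rightarrow> nat \<Rightarrow> ennreal"
  shows "(\<Sum>p. liminf (\<lambda>n. f n p)) \<le> liminf (\<lambda>n. \<Sum>p. f n p)"
  using nn_integral_liminf[of f "count_space UNIV"] by (simp add: nn_integral_count_space_nat)

text \<open>Convergence of the slopes is not known at this stage, so the sum on the left may be
  infinite. Fatou applies because the gaps between \<open>quot\<close> at \<open>1\<close> and at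
  \<open>t n\<close> are nonnegative.\<close>

lemma slope_fatou:
  fixes \<xi> \<zeta> :: "'a::real_inner"
  assumes a: "\<And>p. p \<ge> 2 \<Longrightarrow> 0 \<le> a p" and fin: "Phi a (norm \<xi>) < \<infinity>" "Phi a (norm \<zeta>) < \<infinity>"
    and t: "\<And>n. 0 < t n" "\<And>n. t n \<le> 1" "t \<longlonglongrightarrow> 0"
  shows "(\<Sum>p. ennreal (quot a \<xi> \<zeta> 1 p - slope a \<xi> \<zeta> p))
    \<le> liminf (\<lambda>n. ennreal (phi a (norm \<zeta>) - phi a (norm \<xi>)
          - (phi a (norm (\<xi> + t n *\<^sub>R (\<zeta> - \<xi>))) - phi a (norm \<xi>)) / t n))"
proof -
  \<comment> \<open>The limit of \<open>quot\<close> is one-sided; positivity of \<open>t n\<close>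
    makes the sequence approach \<open>0\<close> from the right.\<close>
  have "filterlim t (at_right 0) sequentially"
    unfolding filterlim_at using t by (auto simp: less_imp_neq[symmetric])
  from filterlim_compose[OF quot_tendsto_slope this]
  have "(\<lambda>n. ennreal (quot a \<xi> \<zeta> 1 p - quot a \<xi> \<zeta> (t n) p)) \<longlonglongrightarrow>
      ennreal (quot a \<xi> \<zeta> 1 p - slope a \<xi> \<zeta> p)" for p
    by (intro tendsto_ennrealI tendsto_diff tendsto_const)
  then have "liminf (\<lambda>n. ennreal (quot a \<xi> \<zeta> 1 p - quot a \<xi> \<zeta> (t n) p)) =
      ennreal (quot a \<xi> \<zeta> 1 p - slope a \<xi> \<zeta> p)" for p
    by (intro lim_imp_Liminf) simp_all
  then have "(\<Sum>p. ennreal (quot a \<xi> \<zeta> 1 p - slope a \<xi> \<zeta> p))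
      \<le> liminf (\<lambda>n. \<Sum>p. ennreal (quot a \<xi> \<zeta> 1 p - quot a \<xi> \<zeta> (t n) p))"
    using suminf_liminf_le[of "\<lambda>n p. ennreal (quot a \<xi> \<zeta> 1 p - quot a \<xi> \<zeta> (t n) p)"] by simp
  also have "(\<lambda>n. \<Sum>p. ennreal (quot a \<xi> \<zeta> 1 p - quot a \<xi> \<zeta> (t n) p)) =
     (\<lambda>n. ennreal (phi a (norm \<zeta>) - phi a (norm \<xi>)
          - (phi a (norm (\<xi> + t n *\<^sub>R (\<zeta> - \<xi>))) - phi a (norm \<xi>)) / t n))"
  proof
    fix n
    have sums: "(\<lambda>p. quot a \<xi> \<zeta> 1 p - quot a \<xi> \<zeta> (t n) p) sums
        (phi a (norm \<zeta>) - phi a (norm \<xi>)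
          - (phi a (norm (\<xi> + t n *\<^sub>R (\<zeta> - \<xi>))) - phi a (norm \<xi>)) / t n)"
      using sums_diff[OF quot_sums[of a, OF a fin, of 1] quot_sums[of a, OF a fin, of "t n"]] t(1,2)[of n]
      by simp
    have "0 \<le> quot a \<xi> \<zeta> 1 p - quot a \<xi> \<zeta> (t n) p" for p
      using quot_le_quot_1[of a "t n" \<xi> \<zeta> p] a t(1,2)[of n] by simp
    from suminf_ennreal2[OF this sums_summable[OF sums]]
    show "(\<Sum>p. ennreal (quot a \<xi> \<zeta> 1 p - quot a \<xi> \<zeta> (t n) p)) =
        ennreal (phi a (norm \<zeta>) - phi a (norm \<xi>)
          - (phi a (norm (\<xi> + t n *\<^sub>R (\<zeta> - \<xi>))) - phi a (norm \<xi>)) / t n)"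
      unfolding sums_unique[OF sums, symmetric] .
  qed
  finally show ?thesis .
qed

section \<open>Measurability and integrability of the energy density\<close>

lemma phi_measurable [measurable]: "phi a \<in> borel_measurable borel"
  unfolding phi_def by measurable

lemma G_measurable [measurable]:
  "(G a \<sigma> :: 'a::euclidean_space \<Rightarrow> ennreal) \<in> borel_measurable borel"
proof -
  have [measurable]: "Phi a \<in> borel_measurable borel"
    unfolding Phi_def by measurable
  show ?thesis unfolding G_def by measurable
qed

lemma slope_measurable [measurable]:
  fixes X Z :: "'b \<Rightarrow> 'a::euclidean_space"
  assumes [measurable]: "X \<in> borel_measurable M" "Z \<in> borel_measurable M"
  shows "(\<lambda>x. slope a (X x) (Z x) p) \<in> borel_measurable M"
  unfolding slope_def by measurable

lemma quot_measurable [measurable]: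
  fixes X Z :: "'b \<Rightarrow> 'a::euclidean_space"
  assumes [measurable]: "X \<in> borel_measurable M" "Z \<in> borel_measurable M"
  shows "(\<lambda>x. quot a (X x) (Z x) t p) \<in> borel_measurable M"
  unfolding quot_def by measurable

lemma G_eq_phi:
  assumes "\<And>p. p \<ge> 2 \<Longrightarrow> 0 \<le> a p" "norm \<xi> \<le> \<sigma>" "Phi a (norm \<xi>) < \<infinity>"
  shows "G a \<sigma> \<xi> = ennreal (phi a (norm \<xi>))"
  using Phi_eq_phi[of a "norm \<xi>"] assms by (simp add: G_def)

text \<open>\<open>G\<close> is infinite outside the ball of radius \<open>\<sigma>\<close>, so a
  finite integral controls the norm as well as the series.\<close>

lemma AE_G_finite:
  fixes X :: "'b \<Rightarrow> 'a::euclidean_space"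
  assumes [measurable]: "X \<in> borel_measurable M" and fin: "(\<integral>\<^sup>+x. G a \<sigma> (X x) \<partial>M) < \<infinity>"
  shows "AE x in M. norm (X x) \<le> \<sigma> \<and> Phi a (norm (X x)) < \<infinity>"
proof -
  have "AE x in M. G a \<sigma> (X x) \<noteq> \<infinity>"
    using fin by (intro nn_integral_PInf_AE) auto
  then show ?thesis
    by eventually_elim (auto simp: G_def less_top split: if_splits)
qed

lemma nn_integral_G_eq:
  fixes X :: "'b \<Rightarrow> 'a::euclidean_space"
  assumes a: "\<And>p. p \<ge> 2 \<Longrightarrow> 0 \<le> a p"
    and "AE x in M. norm (X x) \<le> \<sigma> \<and> Phi a (norm (X x)) < \<infinity>"
  shows "(\<integral>\<^sup>+x. G a \<sigma> (X x) \<partial>M) = (\<integral>\<^sup>+x. ennreal (phi a (norm (X x))) \<partial>M)"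
  by (intro nn_integral_cong_AE eventually_mono[OF assms(2)]) (simp add: G_eq_phi[of a, OF a])

lemma integrable_phi:
  fixes X :: "'b \<Rightarrow> 'a::euclidean_space"
  assumes a: "\<And>p. p \<ge> 2 \<Longrightarrow> 0 \<le> a p"
    and X[measurable]: "X \<in> borel_measurable M" and fin: "(\<integral>\<^sup>+x. G a \<sigma> (X x) \<partial>M) < \<infinity>"
  shows "integrable M (\<lambda>x. phi a (norm (X x)))"
proof (rule integrableI_nonneg)
  show "AE x in M. 0 \<le> phi a (norm (X x))"
    using AE_G_finite[OF X fin] by eventually_elim (simp add: phi_nonneg[of a, OF a])
qed (use nn_integral_G_eq[of a, OF a AE_G_finite[OF X fin]] fin in auto)

lemma phi_segment_le:
  fixes \<xi> \<zeta> :: "'a::real_inner"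
  assumes a: "\<And>p. p \<ge> 2 \<Longrightarrow> 0 \<le> a p" and fin: "Phi a (norm \<xi>) < \<infinity>" "Phi a (norm \<zeta>) < \<infinity>"
    and t: "0 < t" "t \<le> 1"
  shows "(phi a (norm (\<xi> + t *\<^sub>R (\<zeta> - \<xi>))) - phi a (norm \<xi>)) / t \<le> phi a (norm \<zeta>) - phi a (norm \<xi>)"
  using sums_le[OF quot_le_quot_1[of a t \<xi> \<zeta>, OF a t] quot_sums[of a, OF a fin, of t] quot_sums[of a, OF a fin, of 1]] t
  by simp

section \<open>The variational inequality\<close>

text \<open>Here \<open>X\<close> and \<open>Z\<close> stand for the gradients of \<open>u\<close>
  and \<open>v\<close>, and \<open>c\<close> for the integral of \<open>f * (v - u)\<close>;
  \<open>min\<close> is minimality along the segment.\<close>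

lemma variational_inequality:
  fixes X Z :: "'b \<Rightarrow> 'a::euclidean_space"
  assumes a: "\<And>p. p \<ge> 2 \<Longrightarrow> 0 \<le> a p"
    and XZ[measurable]: "X \<in> borel_measurable M" "Z \<in> borel_measurable M"
    and finX: "(\<integral>\<^sup>+x. G a \<sigma> (X x) \<partial>M) < \<infinity>" and finZ: "(\<integral>\<^sup>+x. G a \<sigma> (Z x) \<partial>M) < \<infinity>"
    and min: "\<And>t. 0 < t \<Longrightarrow> t \<le> 1 \<Longrightarrow>
      enn2ereal (\<integral>\<^sup>+x. G a \<sigma> (X x) \<partial>M) \<le> enn2ereal (\<integral>\<^sup>+x. G a \<sigma> (X x + t *\<^sub>R (Z x - X x)) \<partial>M) - ereal (t * c)"
  shows "AE x in M. summable (slope a (X x) (Z x))"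
    and "integrable M (\<lambda>x. \<Sum>p. slope a (X x) (Z x) p)"
    and "c \<le> (\<integral>x. (\<Sum>p. slope a (X x) (Z x) p) \<partial>M)"
proof -
  let ?w = "\<lambda>t x. X x + t *\<^sub>R (Z x - X x)"
  let ?D = "\<lambda>x. \<Sum>p. slope a (X x) (Z x) p"
  let ?K = "\<lambda>x. phi a (norm (Z x)) - phi a (norm (X x)) - ?D x"
  define t where "t n = inverse (real (Suc n))" for n
  have t: "0 < t n" "t n \<le> 1" for n by (simp_all add: t_def field_simps)
  have t0: "t \<longlonglongrightarrow> 0" unfolding t_def by (rule LIMSEQ_inverse_real_of_nat)
  \<comment> \<open>The gap between the quotients at \<open>1\<close> and at \<open>t n\<close>,
    nonnegative by convexity.\<close>
  define H where "H n x = phi a (norm (Z x)) - phi a (norm (X x))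
    - (phi a (norm (?w (t n) x)) - phi a (norm (X x))) / t n" for n x
  \<comment> \<open>An upper bound for the integral of every \<open>H n\<close>, since minimality
    makes the integrated quotient at \<open>t n\<close> at least \<open>c\<close>.\<close>
  define C where "C = (\<integral>x. phi a (norm (Z x)) \<partial>M) - (\<integral>x. phi a (norm (X x)) \<partial>M) - c"
  have [measurable]: "H n \<in> borel_measurable M" for n unfolding H_def by measurable
  note AX = AE_G_finite[OF XZ(1) finX] and AZ = AE_G_finite[OF XZ(2) finZ]
  have iX: "integrable M (\<lambda>x. phi a (norm (X x)))" and iZ: "integrable M (\<lambda>x. phi a (norm (Z x)))"
    using integrable_phi[of a, OF a] XZ finX finZ by blast+
  have nonneg: "0 \<le> phi a (norm \<xi>)" if "Phi a (norm \<xi>) < \<infinity>" for \<xi> :: 'a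
    using phi_nonneg[of a, OF a norm_ge_zero that] .
  have H0: "AE x in M. 0 \<le> H n x" for n
    using AX AZ
  proof eventually_elim
    case (elim x)
    with phi_segment_le[of a "X x" "Z x" "t n", OF a _ _ t] show ?case by (simp add: H_def)
  qed
  have H: "integrable M (H n) \<and> integral\<^sup>L M (H n) \<le> C" for n
  proof -
    have Aw: "AE x in M. norm (?w (t n) x) \<le> \<sigma> \<and> Phi a (norm (?w (t n) x)) < \<infinity>"
      using AX AZ
    proof eventually_elim
      case (elim x)
      with norm_segment_le[of "X x" \<sigma> "Z x" "t n"] Phi_segment_less_top[of a "X x" "Z x" "t n", OF a] t[of n]
      show ?case by (simp add: less_imp_le)
    qed
    \<comment> \<open>Rearranged, \<open>0 \<le> H n x\<close> bounds the intermediate density by a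
      convex combination of the integrable endpoint densities.\<close>
    have iw: "integrable M (\<lambda>x. phi a (norm (?w (t n) x)))"
    proof (rule Bochner_Integration.integrable_bound)
      show "integrable M (\<lambda>x. phi a (norm (X x)) + t n * (phi a (norm (Z x)) - phi a (norm (X x))))"
        using iX iZ by auto
      show "AE x in M. norm (phi a (norm (?w (t n) x)))
          \<le> norm (phi a (norm (X x)) + t n * (phi a (norm (Z x)) - phi a (norm (X x))))"
        using H0[of n] Aw
      proof eventually_elim
        case (elim x)
        then show ?case using t[of n] nonneg[of "?w (t n) x"]
          by (simp add: H_def field_simps)
      qed
    qed measurable
    \<comment> \<open>The densities involved are nonnegative and integrable, so \<open>min\<close>
      becomes an inequality between real numbers.\<close>
    have "ereal (\<integral>x. phi a (norm (X x)) \<partial>M) \<le> ereal (\<integral>x. phi a (norm (?w (t n) x)) \<partial>M) - ereal (t n * c)"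
    proof -
      have "(\<integral>\<^sup>+x. G a \<sigma> (Y x) \<partial>M) = ennreal (\<integral>x. phi a (norm (Y x)) \<partial>M)
          \<and> 0 \<le> (\<integral>x. phi a (norm (Y x)) \<partial>M)"
        if AY: "AE x in M. norm (Y x) \<le> \<sigma> \<and> Phi a (norm (Y x)) < \<infinity>"
          and iY: "integrable M (\<lambda>x. phi a (norm (Y x)))" for Y :: "'b \<Rightarrow> 'a"
      proof -
        have "AE x in M. 0 \<le> phi a (norm (Y x))"
          using AY by eventually_elim (use nonneg in blast)
        then show ?thesis
          using nn_integral_G_eq[of a, OF a AY] nn_integral_eq_integral[OF iY]
          by (auto intro: integral_nonneg_AE)
      qed
      from this[OF AX iX] this[OF Aw iw] min[OF t, of n] show ?thesis by simp
    qed
    then have "c \<le> ((\<integral>x. phi a (norm (?w (t n) x)) \<partial>M) - (\<integral>x. phi a (norm (X x)) \<partial>M)) / t n"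
      using t[of n] by (simp add: field_simps)
    then show ?thesis
      unfolding H_def C_def using iX iZ iw by simp
  qed
  \<comment> \<open>Needed to return from \<open>ennreal C\<close> to \<open>C\<close> at the end,
    as \<open>ennreal\<close> sends negative numbers to \<open>0\<close>.\<close>
  have C0: "0 \<le> C"
    using H[of 0] integral_nonneg_AE[OF H0[of 0]] by linarith
  have "(\<integral>\<^sup>+x. (\<Sum>p. ennreal (quot a (X x) (Z x) 1 p - slope a (X x) (Z x) p)) \<partial>M)
      \<le> (\<integral>\<^sup>+x. liminf (\<lambda>n. ennreal (H n x)) \<partial>M)"
  proof (rule nn_integral_mono_AE)
    show "AE x in M. (\<Sum>p. ennreal (quot a (X x) (Z x) 1 p - slope a (X x) (Z x) p))
        \<le> liminf (\<lambda>n. ennreal (H n x))"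
      using AX AZ unfolding H_def
      by eventually_elim (intro slope_fatou[of a, OF a _ _ t t0]; blast)
  qed
  \<comment> \<open>Fatou's lemma a second time, now for the integral over \<open>M\<close>.\<close>
  also have "\<dots> \<le> liminf (\<lambda>n. \<integral>\<^sup>+x. ennreal (H n x) \<partial>M)"
    by (rule nn_integral_liminf) measurable
  also have "\<dots> = liminf (\<lambda>n. ennreal (integral\<^sup>L M (H n)))"
    using H H0 by (simp add: nn_integral_eq_integral)
  also have "\<dots> \<le> liminf (\<lambda>n::nat. ennreal C)"
    using H by (intro Liminf_mono always_eventually allI ennreal_leI) simp
  finally have le: "(\<integral>\<^sup>+x. (\<Sum>p. ennreal (quot a (X x) (Z x) 1 p - slope a (X x) (Z x) p)) \<partial>M) \<le> ennreal C"
    by (simp add: Liminf_const)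
  then have "AE x in M. (\<Sum>p. ennreal (quot a (X x) (Z x) 1 p - slope a (X x) (Z x) p)) \<noteq> \<infinity>"
    by (intro nn_integral_PInf_AE) (auto simp: top_unique)
  then have *: "AE x in M. summable (slope a (X x) (Z x)) \<and> 0 \<le> ?K x \<and>
      (\<Sum>p. ennreal (quot a (X x) (Z x) 1 p - slope a (X x) (Z x) p)) = ennreal (?K x)"
    using AX AZ
  proof eventually_elim
    case (elim x)
    let ?k = "\<lambda>p. quot a (X x) (Z x) 1 p - slope a (X x) (Z x) p"
    have k0: "0 \<le> ?k p" for p using slope_le_quot[of a 1 "X x" "Z x" p] a by simp
    have k: "summable ?k" using elim by (intro summable_suminf_not_top k0) auto
    have q: "quot a (X x) (Z x) 1 sums (phi a (norm (Z x)) - phi a (norm (X x)))"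
      using quot_sums[of a, OF a, of "X x" "Z x" 1] elim by simp
    \<comment> \<open>A slope is the quotient at \<open>1\<close> minus the gap, and both of these
      series converge.\<close>
    have s: "summable (slope a (X x) (Z x))"
      using summable_diff[OF sums_summable[OF q] k] by simp
    have "suminf ?k = ?K x"
      using suminf_diff[OF sums_summable[OF q] s] sums_unique[OF q] by simp
    with s show ?case
      using suminf_ennreal2[OF k0 k] suminf_nonneg[OF k k0] by simp
  qed
  from * show "AE x in M. summable (slope a (X x) (Z x))" by eventually_elim simp
  have D[measurable]: "?D \<in> borel_measurable M" by measurable
  from le * have le': "(\<integral>\<^sup>+x. ennreal (?K x) \<partial>M) \<le> ennreal C"
    by (subst nn_integral_cong_AE[where v = "\<lambda>x. \<Sum>p. ennreal (quot a (X x) (Z x) 1 p - slope a (X x) (Z x) p)"]) auto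
  have K0: "AE x in M. 0 \<le> ?K x" using * by eventually_elim simp
  have iK: "integrable M ?K"
    by (rule integrableI_nonneg[OF _ K0]) (use le' in \<open>auto intro: le_less_trans\<close>)
  \<comment> \<open>The sum of slopes is recovered by subtracting the integrable \<open>?K\<close>
    from the difference of the two endpoint densities.\<close>
  have "integrable M (\<lambda>x. phi a (norm (Z x)) - phi a (norm (X x)) - ?K x)"
    by (rule Bochner_Integration.integrable_diff[OF Bochner_Integration.integrable_diff[OF iZ iX] iK])
  then show iD: "integrable M ?D" by simp
  have "ennreal (integral\<^sup>L M ?K) \<le> ennreal C"
    using le' nn_integral_eq_integral[OF iK K0] by simp
  then have "integral\<^sup>L M ?K \<le> C" using C0 by simp
  then show "c \<le> integral\<^sup>L M ?D"
    unfolding C_def using iX iZ iD by simp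
qed

section \<open>Termwise integration of the series\<close>

text \<open>Dominated convergence: slopes of a common sign do not cancel, so the absolute value of
  the full sum is a majorant.\<close>

lemma slope_integral_sums:
  fixes X Z :: "'b \<Rightarrow> 'a::euclidean_space"
  assumes a: "\<And>p. p \<ge> 2 \<Longrightarrow> 0 \<le> a p"
    and [measurable]: "X \<in> borel_measurable M" "Z \<in> borel_measurable M"
    and summable: "AE x in M. summable (slope a (X x) (Z x))"
    and int: "integrable M (\<lambda>x. \<Sum>p. slope a (X x) (Z x) p)"
  shows "(\<lambda>p. \<integral>x. slope a (X x) (Z x) p \<partial>M) sums (\<integral>x. (\<Sum>p. slope a (X x) (Z x) p) \<partial>M)"
proof -
  \<comment> \<open>Singletons \<open>F\<close> give integrability of each term, initial segments
    the majorant for the partial sums.\<close>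
  have dom: "AE x in M. \<forall>F. finite F \<longrightarrow> norm (\<Sum>p\<in>F. slope a (X x) (Z x) p) \<le> norm (\<Sum>p. slope a (X x) (Z x) p)"
    using summable
  proof eventually_elim
    case (elim x)
    let ?s = "slope a (X x) (Z x)" and ?e = "sgn (X x \<bullet> (Z x - X x))"
    have abs: "\<bar>?s p\<bar> = ?e * ?s p" for p by (rule abs_slope[of a, OF a])
    have sa: "summable (\<lambda>p. \<bar>?s p\<bar>)"
      using summable_mult[OF elim, of ?e] by (simp only: abs)
    have "norm (\<Sum>p\<in>F. ?s p) \<le> norm (suminf ?s)" if "finite F" for F
    proof -
      have "norm (\<Sum>p\<in>F. ?s p) \<le> (\<Sum>p\<in>F. \<bar>?s p\<bar>)" using norm_sum[of ?s F] by simp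
      also have "\<dots> \<le> (\<Sum>p. \<bar>?s p\<bar>)" using that sa by (intro sum_le_suminf) auto
      also have "\<dots> = ?e * suminf ?s" using suminf_mult[OF elim, of ?e] by (simp only: abs)
      also have "\<dots> \<le> \<bar>suminf ?s\<bar>"
        by (cases "X x \<bullet> (Z x - X x)" "0::real" rule: linorder_cases) auto
      finally show ?thesis by simp
    qed
    then show ?case by blast
  qed
  have slope: "integrable M (\<lambda>x. slope a (X x) (Z x) p)" for p
  proof (rule Bochner_Integration.integrable_bound[OF int])
    show "AE x in M. norm (slope a (X x) (Z x) p) \<le> norm (\<Sum>p. slope a (X x) (Z x) p)"
      using dom by eventually_elim (metis (no_types, lifting) finite.intros sum.insert sum.empty empty_iff add_0_right)
  qed measurable
  have "(\<lambda>n. \<integral>x. (\<Sum>p<n. slope a (X x) (Z x) p) \<partial>M) \<longlonglongrightarrow> (\<integral>x. (\<Sum>p. slope a (X x) (Z x) p) \<partial>M)"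
  proof (rule integral_dominated_convergence)
    show "integrable M (\<lambda>x. norm (\<Sum>p. slope a (X x) (Z x) p))" using int by simp
    show "AE x in M. (\<lambda>n. \<Sum>p<n. slope a (X x) (Z x) p) \<longlonglongrightarrow> (\<Sum>p. slope a (X x) (Z x) p)"
      using summable by eventually_elim (rule summable_LIMSEQ)
    show "AE x in M. norm (\<Sum>p<n. slope a (X x) (Z x) p) \<le> norm (\<Sum>p. slope a (X x) (Z x) p)" for n
      using dom by eventually_elim simp
  qed measurable
  then show ?thesis
    unfolding sums_def using slope by (simp add: Bochner_Integration.integral_sum)
qed

section \<open>Extended-valued integrals and completeness\<close>

lemma ereal_integral_eq:
  assumes "integrable M D" "AE x in M. h x = ereal (D x)"
  shows "ereal_integral M h = ereal (integral\<^sup>L M D)"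
    and "(\<integral>\<^sup>+x. e2ennreal (- h x) \<partial>M) < \<infinity>"
proof -
  have "(\<integral>\<^sup>+x. e2ennreal (h x) \<partial>M) = (\<integral>\<^sup>+x. ennreal (D x) \<partial>M)"
    using assms(2) by (intro nn_integral_cong_AE) (auto simp: e2ennreal_ereal)
  moreover have "(\<integral>\<^sup>+x. e2ennreal (- h x) \<partial>M) = (\<integral>\<^sup>+x. ennreal (- D x) \<partial>M)"
    using assms(2) by (intro nn_integral_cong_AE) (auto simp: e2ennreal_ereal)
  moreover have "(\<integral>\<^sup>+x. ennreal (D x) \<partial>M) < \<infinity>" "(\<integral>\<^sup>+x. ennreal (- D x) \<partial>M) < \<infinity>"
    using assms(1) by (auto simp: real_integrable_def less_top)
  ultimately show "ereal_integral M h = ereal (integral\<^sup>L M D)"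
    and "(\<integral>\<^sup>+x. e2ennreal (- h x) \<partial>M) < \<infinity>"
    unfolding ereal_integral_def real_lebesgue_integral_def[OF assms(1)]
    by (auto simp: less_top_ennreal)
qed

text \<open>The two preimages differ only inside a null set, all of whose subsets are measurable.
  This serves \<open>delta\<close> and \<open>gradient\<close>, whose values are controlled only
  almost everywhere.\<close>

lemma (in complete_measure) measurable_cong_AE_complete:
  assumes f: "f \<in> measurable M N" and ae: "AE x in M. f x = g x"
    and g: "\<And>x. x \<in> space M \<Longrightarrow> g x \<in> space N"
  shows "g \<in> measurable M N"
proof (rule measurableI)
  fix A assume A: "A \<in> sets N"
  have null: "{x \<in> space M. f x \<noteq> g x} \<in> null_sets M"
    using ae AE_iff_null_sets by simp
  have "g -` A \<inter> space M = (f -` A \<inter> space M - {x \<in> space M. f x \<noteq> g x})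
      \<union> (g -` A \<inter> {x \<in> space M. f x \<noteq> g x})"
    by auto
  moreover have "g -` A \<inter> {x \<in> space M. f x \<noteq> g x} \<in> sets M"
    using null by (intro complete[OF _ null]) auto
  ultimately show "g -` A \<inter> space M \<in> sets M"
    using measurable_sets[OF f A] null by auto
qed (use g in auto)

lemma complete_measure_lebesgue_on:
  assumes "S \<in> sets lebesgue"
  shows "complete_measure (lebesgue_on S)"
proof
  fix A B assume "B \<subseteq> A" "A \<in> null_sets (lebesgue_on S)"
  then have "B \<in> null_sets (lebesgue_on S)"
    using assms completion.complete2[of B A]
    by (auto simp: null_sets_restrict_space)
  then show "B \<in> sets (lebesgue_on S)" by auto
qed

section \<open>Gradients and admissible functions\<close>

lemma GDERIV_unique:
  fixes f :: "'a::real_inner \<Rightarrow> real"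
  assumes "GDERIV f x :> D" "GDERIV f x :> E"
  shows "D = E"
proof -
  have "(\<lambda>h. h \<bullet> D) = (\<lambda>h. h \<bullet> E)"
    using assms unfolding gderiv_def by (rule has_derivative_unique)
  then show ?thesis by (metis vector_eq_ldot)
qed

lemma gradient_eqI: "GDERIV f x :> D \<Longrightarrow> gradient f x = D"
  unfolding gradient_def using GDERIV_unique by (intro the_equality) auto

text \<open>Riesz representation: the derivative \<open>f'\<close> is the pairing with
  \<open>adjoint f' 1\<close>.\<close>

lemma differentiable_imp_GDERIV:
  fixes f :: "'a::euclidean_space \<Rightarrow> real"
  assumes "f differentiable (at x)"
  shows "GDERIV f x :> gradient f x"
proof -
  obtain f' where f': "(f has_derivative f') (at x)"
    using assms by (auto simp: differentiable_def)
  have "linear f'" using f' has_derivative_linear by blast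
  then have "f' = (\<lambda>h. h \<bullet> adjoint f' 1)"
    by (simp add: adjoint_works)
  then have "GDERIV f x :> adjoint f' 1"
    using f' by (simp add: gderiv_def)
  then show ?thesis using gradient_eqI by metis
qed

text \<open>Each component is almost everywhere a limit of measurable difference quotients;
  completeness takes care of the remaining points.\<close>

lemma gradient_measurable:
  fixes v :: "'a::euclidean_space \<Rightarrow> real"
  assumes "open \<Omega>" "continuous_on \<Omega> v" and diff: "AE x in lebesgue_on \<Omega>. v differentiable (at x)"
  shows "gradient v \<in> borel_measurable (lebesgue_on \<Omega>)"
proof (rule borel_measurable_euclidean_space[THEN iffD2], rule ballI)
  fix b :: 'a
  \<comment> \<open>Extension by zero gives a Borel function on the whole space, also where
    \<open>x + t n *\<^sub>R b\<close> leaves \<open>\<Omega>\<close>.\<close>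
  define V where "V x = indicator \<Omega> x *\<^sub>R v x" for x
  have \<Omega>: "\<Omega> \<in> sets borel" using assms(1) by simp
  have [measurable]: "V \<in> borel_measurable borel"
    unfolding V_def using \<Omega> assms(2) by (rule borel_measurable_continuous_on_indicator)
  define t where "t n = inverse (real (Suc n))" for n
  define F where "F n x = (V (x + t n *\<^sub>R b) - V x) / t n" for n x
  have "F n \<in> borel_measurable lborel" for n unfolding F_def by measurable
  then have [measurable]: "F n \<in> borel_measurable (lebesgue_on \<Omega>)" for n
    by (intro measurable_restrict_space1 measurable_completion)
  have ae: "AE x in lebesgue_on \<Omega>. lim (\<lambda>n. F n x) = gradient v x \<bullet> b"
  proof (rule AE_mp[OF diff], rule AE_I2, rule impI)
    fix x assume x: "x \<in> space (lebesgue_on \<Omega>)" and "v differentiable (at x)"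
    then have "(v has_derivative (\<lambda>h. h \<bullet> gradient v x)) (at x)"
      using differentiable_imp_GDERIV by (auto simp: gderiv_def)
    then have "((\<lambda>s. v (x + s *\<^sub>R b)) has_derivative (\<lambda>s. (s *\<^sub>R b) \<bullet> gradient v x)) (at 0)"
      by (intro has_derivative_compose[where g = v and f = "\<lambda>s. x + s *\<^sub>R b" and g' = "\<lambda>h. h \<bullet> gradient v x"])
         (auto intro!: derivative_eq_intros)
    then have "((\<lambda>s. v (x + s *\<^sub>R b)) has_field_derivative (b \<bullet> gradient v x)) (at 0)"
      unfolding has_field_derivative_def by (simp add: mult.commute[of _ "b \<bullet> gradient v x"])
    then have lim: "(\<lambda>s. (v (x + s *\<^sub>R b) - v x) / s) \<midarrow>0\<rightarrow> b \<bullet> gradient v x"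
      by (simp add: DERIV_def)
    have t0: "t \<longlonglongrightarrow> 0" unfolding t_def by (rule LIMSEQ_inverse_real_of_nat)
    then have "filterlim t (at 0) sequentially"
      by (auto simp: filterlim_at t_def)
    from filterlim_compose[OF lim this]
    have "(\<lambda>n. (v (x + t n *\<^sub>R b) - v x) / t n) \<longlonglongrightarrow> b \<bullet> gradient v x" .
    \<comment> \<open>As \<open>\<Omega>\<close> is open, the shifted points eventually lie in it,
      where \<open>V\<close> and \<open>v\<close> agree.\<close>
    moreover have "\<forall>\<^sub>F n in sequentially. (v (x + t n *\<^sub>R b) - v x) / t n = F n x"
    proof -
      have "(\<lambda>n. x + t n *\<^sub>R b) \<longlonglongrightarrow> x + 0 *\<^sub>R b" by (intro tendsto_intros t0)
      then have "\<forall>\<^sub>F n in sequentially. x + t n *\<^sub>R b \<in> \<Omega>"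
        using topological_tendstoD[OF _ assms(1), of "\<lambda>n. x + t n *\<^sub>R b" x] x by simp
      then show ?thesis
        by eventually_elim (use x in \<open>simp add: F_def V_def\<close>)
    qed
    ultimately have "(\<lambda>n. F n x) \<longlonglongrightarrow> b \<bullet> gradient v x"
      by (rule Lim_transform_eventually)
    then show "lim (\<lambda>n. F n x) = gradient v x \<bullet> b"
      by (simp add: limI inner_commute)
  qed
  have meas: "(\<lambda>x. lim (\<lambda>n. F n x)) \<in> borel_measurable (lebesgue_on \<Omega>)"
    by (intro borel_measurable_lim_metric) measurable
  have complete: "complete_measure (lebesgue_on \<Omega>)"
    using \<Omega> by (intro complete_measure_lebesgue_on) simp
  show "(\<lambda>x. gradient v x \<bullet> b) \<in> borel_measurable (lebesgue_on \<Omega>)"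
    by (rule complete_measure.measurable_cong_AE_complete[OF complete meas ae]) simp
qed

text \<open>Provides the competitors on the segment from \<open>u\<close> to \<open>v\<close>. The
  gradient formula comes from linearity at points where both functions are differentiable.\<close>

lemma convex_combination_admissible:
  fixes \<Omega> :: "'a::euclidean_space set"
  assumes u: "u \<in> admissible \<Omega> \<sigma> g" and v: "v \<in> admissible \<Omega> \<sigma> g" and t: "0 \<le> t" "t \<le> 1"
  shows "(\<lambda>x. u x + t * (v x - u x)) \<in> admissible \<Omega> \<sigma> g"
    and "AE x in lebesgue_on \<Omega>. gradient (\<lambda>x. u x + t * (v x - u x)) x
      = gradient u x + t *\<^sub>R (gradient v x - gradient u x)"
proof -
  let ?w = "\<lambda>x. u x + t * (v x - u x)"
  have du: "AE x in lebesgue_on \<Omega>. u differentiable (at x) \<and> norm (gradient u x) \<le> \<sigma>"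
    and dv: "AE x in lebesgue_on \<Omega>. v differentiable (at x) \<and> norm (gradient v x) \<le> \<sigma>"
    using u v by (auto simp: admissible_def)
  have grad: "AE x in lebesgue_on \<Omega>. ?w differentiable (at x) \<and> norm (gradient ?w x) \<le> \<sigma> \<and>
      gradient ?w x = gradient u x + t *\<^sub>R (gradient v x - gradient u x)"
    using du dv
  proof eventually_elim
    case (elim x)
    have "(u has_derivative (\<lambda>h. h \<bullet> gradient u x)) (at x)" "(v has_derivative (\<lambda>h. h \<bullet> gradient v x)) (at x)"
      using elim differentiable_imp_GDERIV by (auto simp: gderiv_def)
    then have "(?w has_derivative (\<lambda>h. h \<bullet> gradient u x + t * (h \<bullet> gradient v x - h \<bullet> gradient u x))) (at x)"
      by (intro derivative_intros)
    then have *: "GDERIV ?w x :> gradient u x + t *\<^sub>R (gradient v x - gradient u x)"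
      by (simp add: gderiv_def inner_simps)
    have "norm (gradient u x + t *\<^sub>R (gradient v x - gradient u x)) \<le> \<sigma>"
      using elim t by (intro norm_segment_le) auto
    then show ?case
      unfolding gradient_eqI[OF *] using * by (auto simp: gderiv_def differentiable_def)
  qed
  then show "AE x in lebesgue_on \<Omega>. gradient ?w x = gradient u x + t *\<^sub>R (gradient v x - gradient u x)"
    by eventually_elim simp
  obtain C D where "C-lipschitz_on (closure \<Omega>) u" "D-lipschitz_on (closure \<Omega>) v"
    using u v by (auto simp: admissible_def lipschitz_fun_on_def)
  then have "(C + \<bar>t\<bar> * (D + C))-lipschitz_on (closure \<Omega>) ?w"
    by (intro lipschitz_on_add lipschitz_on_cmult_real lipschitz_on_diff)
  then show "?w \<in> admissible \<Omega> \<sigma> g"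
    unfolding admissible_def lipschitz_fun_on_def
  proof (intro CollectI conjI)
    show "AE x in lebesgue_on \<Omega>. ?w differentiable (at x) \<and> norm (gradient ?w x) \<le> \<sigma>"
      using grad by eventually_elim blast
    show "\<forall>x\<in>frontier \<Omega>. ?w x = g x"
      using u v by (simp add: admissible_def)
  qed blast
qed

text \<open>A Lipschitz function is bounded on the compact closure, so a multiple of
  \<open>f\<close> dominates the product.\<close>

lemma integrable_mult_admissible:
  fixes \<Omega> :: "'a::euclidean_space set"
  assumes "bounded \<Omega>" "open \<Omega>" "integrable (lebesgue_on \<Omega>) f" "v \<in> admissible \<Omega> \<sigma> g"
  shows "integrable (lebesgue_on \<Omega>) (\<lambda>x. f x * v x)"
proof -
  have cont: "continuous_on (closure \<Omega>) v"
    using assms(4) lipschitz_on_continuous_on by (auto simp: admissible_def lipschitz_fun_on_def)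
  have "compact (closure \<Omega>)" using assms(1) by simp
  from compact_continuous_image[OF cont this] obtain B where B: "\<And>x. x \<in> closure \<Omega> \<Longrightarrow> norm (v x) \<le> B"
    using compact_imp_bounded bounded_iff by (metis imageI)
  have [measurable]: "v \<in> borel_measurable (lebesgue_on \<Omega>)"
    using continuous_on_subset[OF cont closure_subset] assms(2)
    by (intro continuous_imp_measurable_on_sets_lebesgue) auto
  have [measurable]: "f \<in> borel_measurable (lebesgue_on \<Omega>)" using assms(3) by auto
  show ?thesis
  proof (rule Bochner_Integration.integrable_bound)
    show "integrable (lebesgue_on \<Omega>) (\<lambda>x. B * f x)" using assms(3) by simp
    show "AE x in lebesgue_on \<Omega>. norm (f x * v x) \<le> norm (B * f x)"
    proof (rule AE_I2)
      fix x assume "x \<in> space (lebesgue_on \<Omega>)"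
      then have "\<bar>v x\<bar> \<le> \<bar>B\<bar>" using B[of x] closure_subset[of \<Omega>] by fastforce
      then show "norm (f x * v x) \<le> norm (B * f x)"
        by (simp add: abs_mult mult.commute[of "\<bar>B\<bar>"] mult_left_mono)
    qed
  qed measurable
qed

lemma gradient_diff:
  fixes u v :: "'a::euclidean_space \<Rightarrow> real"
  assumes "u differentiable (at x)" "v differentiable (at x)"
  shows "gradient (\<lambda>y. v y - u y) x = gradient v x - gradient u x"
  using assms by (intro gradient_eqI GDERIV_diff differentiable_imp_GDERIV)

section \<open>The saturated set for infinite \<open>Lambda\<close>\<close>

text \<open>On the sphere of radius \<open>\<sigma>\<close> the slopes are proportional to the terms
  of \<open>Lambda\<close>, so convergence forces the inner product to vanish.\<close>

lemma summable_slope_imp_eq: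
  fixes \<xi> \<zeta> :: "'a::real_inner"
  assumes a: "\<And>p. p \<ge> 2 \<Longrightarrow> 0 \<le> a p" and \<sigma>: "norm \<xi> = \<sigma>" "0 < \<sigma>" "norm \<zeta> \<le> \<sigma>"
    and top: "Lambda a \<sigma> = \<infinity>" and sum: "summable (slope a \<xi> \<zeta>)"
  shows "\<zeta> = \<xi>"
proof -
  have "\<xi> \<bullet> (\<zeta> - \<xi>) = 0"
  proof (rule ccontr)
    assume nz: "\<xi> \<bullet> (\<zeta> - \<xi>) \<noteq> 0"
    \<comment> \<open>The factor turns \<open>a (p + 2) * \<sigma> ^ p * (\<xi> \<bullet> (\<zeta> -
      \<xi>))\<close> into the corresponding term of \<open>Lambda\<close>.\<close>
    have "summable (\<lambda>p. \<sigma> / (\<xi> \<bullet> (\<zeta> - \<xi>)) * slope a \<xi> \<zeta> p)"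
      using sum by (rule summable_mult)
    then have "summable (\<lambda>p. a (p + 2) * \<sigma> ^ (p + 1))"
      using nz \<sigma> by (simp add: slope_def mult_ac)
    moreover have "0 \<le> a (p + 2) * \<sigma> ^ (p + 1)" for p
      using a[of "p + 2"] \<sigma> by simp
    ultimately have "Lambda a \<sigma> = ennreal (\<Sum>p. a (p + 2) * \<sigma> ^ (p + 1))"
      unfolding Lambda_def by (intro suminf_ennreal2)
    then show False using top by simp
  qed
  moreover have "norm \<zeta> ^ 2 \<le> norm \<xi> ^ 2" using \<sigma> by (simp add: power_mono)
  \<comment> \<open>The squared distance equals \<open>norm \<zeta> ^ 2 - norm \<xi> ^ 2 - 2 *
    (\<xi> \<bullet> (\<zeta> - \<xi>))\<close>.\<close>
  ultimately have "norm (\<zeta> - \<xi>) ^ 2 \<le> 0"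
    by (simp add: power2_norm_eq_inner inner_diff inner_commute)
  then show ?thesis by simp
qed

section \<open>Application to the minimizer\<close>

theorem theorem3p7:
  fixes \<Omega> :: "'a::euclidean_space set"
    and a :: "nat \<Rightarrow> real" and \<sigma> :: real
    and f g u v :: "'a \<Rightarrow> real"
  assumes "bounded \<Omega>" and "connected \<Omega>" and "open \<Omega>" and "lipschitz_boundary \<Omega>"
    and "\<And>p. p \<ge> 2 \<Longrightarrow> a p \<ge> 0" and "a 2 > 0" and "infinite {p. p \<ge> 2 \<and> a p \<noteq> 0}"
    and "0 < \<sigma>" and "limsup (\<lambda>p. ereal (root p (a p))) = ereal (1 / \<sigma>)"
    and "integrable (lebesgue_on \<Omega>) f"
    and "lipschitz_fun_on (frontier \<Omega>) g" and "lipschitz_const (frontier \<Omega>) g \<le> ereal \<sigma>"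
    and "\<exists>gbar \<in> admissible \<Omega> \<sigma> g. energy \<Omega> a \<sigma> f gbar < \<infinity>"
    and "is_arg_min (energy \<Omega> a \<sigma> f) (\<lambda>w. w \<in> admissible \<Omega> \<sigma> g) u"
    and "v \<in> admissible \<Omega> \<sigma> g" and "energy \<Omega> a \<sigma> f v < \<infinity>"
  defines "\<Sigma> \<equiv> {x \<in> \<Omega>. norm (gradient u x) = \<sigma>}"
    and "\<delta>v \<equiv> (\<lambda>x. delta a \<sigma> (gradient u x) (gradient v x))"
    and "S \<equiv> (\<lambda>n::nat. ereal (\<Sum>p = 2..n. a p *
           (\<integral>x. (norm (gradient u x) ^ (p - 2) *\<^sub>R gradient u x)
                   \<bullet> gradient (\<lambda>y. v y - u y) x \<partial>lebesgue_on \<Omega>)))"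
  shows "(Lambda a \<sigma> = \<infinity> \<longrightarrow> (AE x in lebesgue_on \<Omega>. x \<in> \<Sigma> \<longrightarrow> gradient v x = gradient u x))
    \<and> (\<delta>v \<in> borel_measurable (lebesgue_on \<Omega>)
       \<and> neg_part_L1 (lebesgue_on \<Omega>) \<delta>v
       \<and> ereal (\<integral>x. f x * (v x - u x) \<partial>lebesgue_on \<Omega>) \<le> ereal_integral (lebesgue_on \<Omega>) \<delta>v)
    \<and> (- \<infinity> < ereal_integral (lebesgue_on \<Omega>) \<delta>v
       \<and> S \<longlonglongrightarrow> ereal_integral (lebesgue_on \<Omega>) \<delta>v
       \<and> ereal (\<integral>x. f x * (v x - u x) \<partial>lebesgue_on \<Omega>) \<le> lim S)"
proof -
  let ?M = "lebesgue_on \<Omega>"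
  let ?D = "\<lambda>x. \<Sum>p. slope a (gradient u x) (gradient v x) p"
  define c where "c = (\<integral>x. f x * (v x - u x) \<partial>?M)"
  note a = assms(5) and v = assms(15)
  have u: "u \<in> admissible \<Omega> \<sigma> g"
    and min: "\<And>w. w \<in> admissible \<Omega> \<sigma> g \<Longrightarrow> energy \<Omega> a \<sigma> f u \<le> energy \<Omega> a \<sigma> f w"
    using assms(14) by (auto simp: is_arg_min_def not_less)
  have cont: "continuous_on \<Omega> w" if "w \<in> admissible \<Omega> \<sigma> g" for w
    using that lipschitz_on_continuous_on continuous_on_subset closure_subset
    unfolding admissible_def lipschitz_fun_on_def by blast
  have diff: "AE x in ?M. w differentiable (at x) \<and> norm (gradient w x) \<le> \<sigma>" if "w \<in> admissible \<Omega> \<sigma> g" for w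
    using that by (simp add: admissible_def)
  have meas: "gradient w \<in> borel_measurable ?M" if "w \<in> admissible \<Omega> \<sigma> g" for w
    using diff[OF that] by (intro gradient_measurable assms(3) cont that) (auto elim: eventually_mono)
  note [measurable] = meas[OF u] meas[OF v]
  \<comment> \<open>The load term is a real number, so it cannot compensate an infinite integral of
    \<open>G\<close>.\<close>
  have fin: "(\<integral>\<^sup>+x. G a \<sigma> (gradient w x) \<partial>?M) < \<infinity>" if "energy \<Omega> a \<sigma> f w < \<infinity>" for w
    using that unfolding energy_def by (cases "\<integral>\<^sup>+x. G a \<sigma> (gradient w x) \<partial>?M") (auto simp: less_top)
  have finv: "(\<integral>\<^sup>+x. G a \<sigma> (gradient v x) \<partial>?M) < \<infinity>" by (rule fin[OF assms(16)])
  have finu: "(\<integral>\<^sup>+x. G a \<sigma> (gradient u x) \<partial>?M) < \<infinity>"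
    by (rule fin[OF le_less_trans[OF min[OF v] assms(16)]])
  have fu: "integrable ?M (\<lambda>x. f x * u x)" and fv: "integrable ?M (\<lambda>x. f x * v x)"
    using integrable_mult_admissible assms(1,3,10) u v by blast+
  have c: "c = (\<integral>x. f x * v x \<partial>?M) - (\<integral>x. f x * u x \<partial>?M)"
    unfolding c_def using fu fv by (simp add: right_diff_distrib)
  \<comment> \<open>Minimality against \<open>u + t (v - u)\<close>: the load of \<open>u\<close>
    occurs on both sides and cancels, leaving \<open>t * c\<close>.\<close>
  have vi: "enn2ereal (\<integral>\<^sup>+x. G a \<sigma> (gradient u x) \<partial>?M)
      \<le> enn2ereal (\<integral>\<^sup>+x. G a \<sigma> (gradient u x + t *\<^sub>R (gradient v x - gradient u x)) \<partial>?M) - ereal (t * c)"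
    if t: "0 < t" "t \<le> 1" for t
  proof -
    let ?w = "\<lambda>x. u x + t * (v x - u x)"
    note w = convex_combination_admissible[OF u v less_imp_le[OF t(1)] t(2)]
    have "(\<integral>x. f x * ?w x \<partial>?M) = (\<integral>x. f x * u x + t * (f x * v x - f x * u x) \<partial>?M)"
      by (simp add: algebra_simps)
    also have "\<dots> = (\<integral>x. f x * u x \<partial>?M) + t * c"
      unfolding c using fu fv by simp
    finally have "enn2ereal (\<integral>\<^sup>+x. G a \<sigma> (gradient u x) \<partial>?M) - ereal (\<integral>x. f x * u x \<partial>?M)
        \<le> enn2ereal (\<integral>\<^sup>+x. G a \<sigma> (gradient ?w x) \<partial>?M) - ereal ((\<integral>x. f x * u x \<partial>?M) + t * c)"
      using min[OF w(1)] unfolding energy_def by simp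
    moreover have "(\<integral>\<^sup>+x. G a \<sigma> (gradient ?w x) \<partial>?M)
        = (\<integral>\<^sup>+x. G a \<sigma> (gradient u x + t *\<^sub>R (gradient v x - gradient u x)) \<partial>?M)"
      by (intro nn_integral_cong_AE eventually_mono[OF w(2)]) simp
    ultimately show ?thesis
      by (cases "enn2ereal (\<integral>\<^sup>+x. G a \<sigma> (gradient u x) \<partial>?M)";
          cases "enn2ereal (\<integral>\<^sup>+x. G a \<sigma> (gradient u x + t *\<^sub>R (gradient v x - gradient u x)) \<partial>?M)") auto
  qed
  have var: "AE x in ?M. summable (slope a (gradient u x) (gradient v x))" "integrable ?M ?D" "c \<le> integral\<^sup>L ?M ?D"
    using variational_inequality[of a, OF _ meas[OF u] meas[OF v] finu finv, of c] a vi by blast+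
  have \<delta>: "AE x in ?M. \<delta>v x = ereal (?D x)"
    using var(1) AE_G_finite[OF meas[OF u] finu] AE_G_finite[OF meas[OF v] finv]
  proof eventually_elim
    case (elim x)
    then show ?case unfolding \<delta>v_def by (intro delta_eq_suminf_slope[of a, OF a]) auto
  qed
  have complete: "complete_measure ?M"
    using assms(3) by (intro complete_measure_lebesgue_on) simp
  have D: "(\<lambda>x. ereal (?D x)) \<in> borel_measurable ?M" by measurable
  \<comment> \<open>\<open>delta\<close> is identified with the measurable series only almost
    everywhere; completeness transfers measurability.\<close>
  have \<delta>_meas: "\<delta>v \<in> borel_measurable ?M"
    by (rule complete_measure.measurable_cong_AE_complete[OF complete D])
      (use \<delta> in \<open>auto elim: eventually_mono\<close>)
  \<comment> \<open>The integral is a real number, so the limit of \<open>S\<close> is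
    finite.\<close>
  have int: "ereal_integral ?M \<delta>v = ereal (integral\<^sup>L ?M ?D)"
    by (rule ereal_integral_eq[OF var(2) \<delta>])
  have "neg_part_L1 ?M \<delta>v"
    unfolding neg_part_L1_def using \<delta>_meas ereal_integral_eq(2)[OF var(2) \<delta>] by simp
  moreover have "AE x in ?M. x \<in> \<Sigma> \<longrightarrow> gradient v x = gradient u x" if "Lambda a \<sigma> = \<infinity>"
    using var(1) diff[OF v]
  proof eventually_elim
    case (elim x)
    then show ?case
      using summable_slope_imp_eq[of a "gradient u x" \<sigma> "gradient v x", OF a _ assms(8) _ that]
      by (auto simp: \<Sigma>_def)
  qed
  moreover have S: "S \<longlonglongrightarrow> ereal (integral\<^sup>L ?M ?D)"
  proof -
    have "a (p + 2) * (\<integral>x. (norm (gradient u x) ^ p *\<^sub>R gradient u x) \<bullet> gradient (\<lambda>y. v y - u y) x \<partial>?M)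
        = (\<integral>x. slope a (gradient u x) (gradient v x) p \<partial>?M)" for p
    proof -
      \<comment> \<open>The gradient of the difference splits only where both functions are
        differentiable, so its measurability too is obtained from completeness.\<close>
      have grad: "AE x in ?M. gradient v x - gradient u x = gradient (\<lambda>y. v y - u y) x"
        using diff[OF u] diff[OF v] by eventually_elim (simp add: gradient_diff)
      have "(\<lambda>x. gradient v x - gradient u x) \<in> borel_measurable ?M" by measurable
      then have [measurable]: "gradient (\<lambda>y. v y - u y) \<in> borel_measurable ?M"
        by (rule complete_measure.measurable_cong_AE_complete[OF complete _ grad]) simp
      have "(\<integral>x. (norm (gradient u x) ^ p *\<^sub>R gradient u x) \<bullet> gradient (\<lambda>y. v y - u y) x \<partial>?M)
          = (\<integral>x. (norm (gradient u x) ^ p *\<^sub>R gradient u x) \<bullet> (gradient v x - gradient u x) \<partial>?M)"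
      proof (rule integral_cong_AE)
        show "AE x in ?M. (norm (gradient u x) ^ p *\<^sub>R gradient u x) \<bullet> gradient (\<lambda>y. v y - u y) x
            = (norm (gradient u x) ^ p *\<^sub>R gradient u x) \<bullet> (gradient v x - gradient u x)"
          using grad by eventually_elim simp
      qed measurable
      then show ?thesis by (simp add: slope_def)
    qed
    \<comment> \<open>The exponents \<open>2\<close> to \<open>n + 2\<close> are the first
      \<open>Suc n\<close> indices of the shifted series; dropping \<open>S 0\<close> and
      \<open>S 1\<close> does not affect the limit.\<close>
    moreover have "(\<Sum>p = 2..n + 2. h p) = (\<Sum>p<Suc n. h (p + 2))" for h :: "nat \<Rightarrow> real" and n
      using sum.shift_bounds_cl_nat_ivl[of h 0 2 n]
      by (simp only: add_0 atLeast0AtMost lessThan_Suc_atMost)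
    ultimately have "(\<lambda>n. S (n + 2)) = (\<lambda>n. ereal (\<Sum>p<Suc n. \<integral>x. slope a (gradient u x) (gradient v x) p \<partial>?M))"
      unfolding S_def
      by (simp only: add_diff_cancel_right')
    moreover have "(\<lambda>n. ereal (\<Sum>p<Suc n. \<integral>x. slope a (gradient u x) (gradient v x) p \<partial>?M))
        \<longlonglongrightarrow> ereal (integral\<^sup>L ?M ?D)"
      using slope_integral_sums[of a, OF a meas[OF u] meas[OF v] var(1,2)]
      unfolding sums_def by (intro tendsto_ereal LIMSEQ_Suc)
    ultimately show ?thesis by (metis LIMSEQ_offset)
  qed
  moreover have "ereal c \<le> ereal (integral\<^sup>L ?M ?D)" using var(3) by simp
  ultimately show ?thesis
    using \<delta>_meas limI[OF S] unfolding int c_def by simp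
qed

end
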